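(* Let $d > 0$ and $0<\alpha\le 1$. Then there is a constant $c = c(d,\alpha) > 0$, depending only on $d$ and $\alpha$, such that the following holds: for every $n \in \mathbb{N}$, every $m \in \{1,\ldots,n-1\}$, every $V \in G(n,n-m)$, and every purely $m$-unrectifiable measure $\mu$ on $\mathbb{R}^n$ satisfying \[ \limsup_{r \downarrow 0} \frac{\mu\bigl(B(x,2r)\bigr)}{\mu\bigl(B(x,r)\bigr)} < d \quad \text{for $\mu$-almost all } x \in \mathbb{R}^n, \] it holds that \[ \limsup_{r \downarrow 0} \frac{\mu\bigl( X(x,r,V,\alpha) \bigr)}{\mu\bigl( B(x,r) \bigr)} \ge c \] for $\mu$-almost every $x \in \mathbb{R}^n$.
   Context: A measure means a locally finite, nontrivial, Borel regular outer measure defined on all subsets of $\mathbb{R}^n$. $G(n,n-m)$ denotes the space of all $(n-m)$-dimensional linear subspaces of $\mathbb{R}^n$. $B(x,r)$ is the closed ball with center $x$ and radius $r$. For $x \in \mathbb{R}^n$, $V \in G(n,n-m)$, $0<\alpha\le1$, $r>0$: $X(x,V,\alpha) = \{ y \in \mathbb{R}^n : \operatorname{dist}(y-x,V) < \alpha|y-x| \}$ and $X(x,r,V,\alpha) = B(x,r) \cap X(x,V,\alpha)$. A set $A \subset \mathbb{R}^n$ is $m$-rectifiable if there are Lipschitz maps $f_i \colon \mathbb{R}^m \to \mathbb{R}^n$, $i=1,2,\ldots$, such that $\mathcal{H}^m\bigl(A \setminus \bigcup_i f_i(\mathbb{R}^m)\bigr) = 0$, where $\mathcal{H}^m$ is the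 $m$-dimensional Hausdorff measure. A measure $\mu$ on $\mathbb{R}^n$ is purely $m$-unrectifiable if $\mu(A) = 0$ for every $m$-rectifiable set $A \subset \mathbb{R}^n$. *)

theory Defs
  imports "HOL-Analysis.Analysis" "HOL-Library.Liminf_Limsup"
begin

text \<open>Euclidean n-space R^n is represented uniformly in n as the set of functions
  nat => real vanishing from index n on (coordinates 0..n-1).\<close>

definition RR :: "nat \<Rightarrow> (nat \<Rightarrow> real) set" where
  "RR n = {x. \<forall>i\<ge>n. x i = 0}"

definition edist :: "nat \<Rightarrow> (nat \<Rightarrow> real) \<Rightarrow> (nat \<Rightarrow> real) \<Rightarrow> real" where
  "edist n x y = sqrt (\<Sum>i<n. (x i - y i)^2)"

definition cb :: "nat \<Rightarrow> (nat \<Rightarrow> real) \<Rightarrow> real \<Rightarrow> (nat \<Rightarrow> real) set" where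
  "cb n x r = {y \<in> RR n. edist n x y \<le> r}"

definition grass :: "nat \<Rightarrow> nat \<Rightarrow> (nat \<Rightarrow> real) set \<Rightarrow> bool" where
  "grass n k V \<longleftrightarrow> (\<exists>b :: nat \<Rightarrow> (nat \<Rightarrow> real).
      (\<forall>j<k. b j \<in> RR n) \<and>
      (\<forall>t :: nat \<Rightarrow> real. (\<forall>i. (\<Sum>j<k. t j * b j i) = 0) \<longrightarrow> (\<forall>j<k. t j = 0)) \<and>
      V = {(\<lambda>i. \<Sum>j<k. t j * b j i) | t :: nat \<Rightarrow> real. True})"

definition setdist_e :: "nat \<Rightarrow> (nat \<Rightarrow> real) \<Rightarrow> (nat \<Rightarrow> real) set \<Rightarrow> real" where
  "setdist_e n z V = Inf {edist n z v | v. v \<in> V}"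

definition cone :: "nat \<Rightarrow> (nat \<Rightarrow> real) \<Rightarrow> (nat \<Rightarrow> real) set \<Rightarrow> real \<Rightarrow> (nat \<Rightarrow> real) set" where
  "cone n x V \<alpha> = {y \<in> RR n. setdist_e n (\<lambda>i. y i - x i) V < \<alpha> * edist n y x}"

definition cone_ball :: "nat \<Rightarrow> (nat \<Rightarrow> real) \<Rightarrow> real \<Rightarrow> (nat \<Rightarrow> real) set \<Rightarrow> real \<Rightarrow> (nat \<Rightarrow> real) set" where
  "cone_ball n x r V \<alpha> = cb n x r \<inter> cone n x V \<alpha>"

definition ediam :: "nat \<Rightarrow> (nat \<Rightarrow> real) set \<Rightarrow> ennreal" where
  "ediam n C = (SUP p \<in> C \<times> C. ennreal (edist n (fst p) (snd p)))"

definition hausdorff_delta :: "nat \<Rightarrow> nat \<Rightarrow> real \<Rightarrow> (nat \<Rightarrow> real) set \<Rightarrow> ennreal" where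
  "hausdorff_delta n m \<delta> A =
     (INF C \<in> {C :: nat \<Rightarrow> (nat \<Rightarrow> real) set.
                  (\<forall>i. C i \<subseteq> RR n \<and> ediam n (C i) \<le> ennreal \<delta>) \<and> A \<subseteq> (\<Union>i. C i)}.
        (\<Sum>i. ennreal (pi powr (real m / 2) / Gamma (real m / 2 + 1) / 2 ^ m) * ediam n (C i) ^ m))"

definition hausdorff :: "nat \<Rightarrow> nat \<Rightarrow> (nat \<Rightarrow> real) set \<Rightarrow> ennreal" where
  "hausdorff n m A = (SUP \<delta> \<in> {0<..}. hausdorff_delta n m \<delta> A)"

definition lipschitz_e :: "nat \<Rightarrow> nat \<Rightarrow> ((nat \<Rightarrow> real) \<Rightarrow> (nat \<Rightarrow> real)) \<Rightarrow> bool" where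
  "lipschitz_e m n f \<longleftrightarrow> f ` RR m \<subseteq> RR n \<and>
     (\<exists>L. \<forall>x\<in>RR m. \<forall>y\<in>RR m. edist n (f x) (f y) \<le> L * edist m x y)"

definition rectifiable :: "nat \<Rightarrow> nat \<Rightarrow> (nat \<Rightarrow> real) set \<Rightarrow> bool" where
  "rectifiable n m A \<longleftrightarrow> A \<subseteq> RR n \<and>
     (\<exists>f :: nat \<Rightarrow> (nat \<Rightarrow> real) \<Rightarrow> (nat \<Rightarrow> real).
        (\<forall>i. lipschitz_e m n (f i)) \<and> hausdorff n m (A - (\<Union>i. f i ` RR m)) = 0)"

definition eopen :: "nat \<Rightarrow> (nat \<Rightarrow> real) set \<Rightarrow> bool" where
  "eopen n U \<longleftrightarrow> U \<subseteq> RR n \<and> (\<forall>x\<in>U. \<exists>e>0. {y \<in> RR n. edist n x y < e} \<subseteq> U)"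

definition borel_e :: "nat \<Rightarrow> (nat \<Rightarrow> real) set set" where
  "borel_e n = sigma_sets (RR n) {U. eopen n U}"

text \<open>A measure on R^n: locally finite, nontrivial, Borel regular outer measure
  defined on all subsets of R^n (values on sets not contained in R^n are irrelevant).\<close>
definition is_measure :: "nat \<Rightarrow> ((nat \<Rightarrow> real) set \<Rightarrow> ennreal) \<Rightarrow> bool" where
  "is_measure n \<mu> \<longleftrightarrow>
     \<mu> {} = 0 \<and>
     (\<forall>A B. A \<subseteq> B \<and> B \<subseteq> RR n \<longrightarrow> \<mu> A \<le> \<mu> B) \<and>
     (\<forall>A :: nat \<Rightarrow> (nat \<Rightarrow> real) set. (\<forall>i. A i \<subseteq> RR n) \<longrightarrow> \<mu> (\<Union>i. A i) \<le> (\<Sum>i. \<mu> (A i))) \<and>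
     (\<forall>B \<in> borel_e n. \<forall>T. T \<subseteq> RR n \<longrightarrow> \<mu> T = \<mu> (T \<inter> B) + \<mu> (T - B)) \<and>
     (\<forall>A. A \<subseteq> RR n \<longrightarrow> (\<exists>B \<in> borel_e n. A \<subseteq> B \<and> \<mu> B = \<mu> A)) \<and>
     (\<forall>x \<in> RR n. \<exists>r>0. \<mu> (cb n x r) < \<infinity>) \<and>
     \<mu> (RR n) \<noteq> 0"

definition purely_unrectifiable :: "nat \<Rightarrow> nat \<Rightarrow> ((nat \<Rightarrow> real) set \<Rightarrow> ennreal) \<Rightarrow> bool" where
  "purely_unrectifiable n m \<mu> \<longleftrightarrow> (\<forall>A. rectifiable n m A \<longrightarrow> \<mu> A = 0)"

definition ae_e :: "nat \<Rightarrow> ((nat \<Rightarrow> real) set \<Rightarrow> ennreal) \<Rightarrow> ((nat \<Rightarrow> real) \<Rightarrow> bool) \<Rightarrow> bool" where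
  "ae_e n \<mu> P \<longleftrightarrow> \<mu> {x \<in> RR n. \<not> P x} = 0"

end

theory Submission
  imports Defs "HOL-Library.Function_Algebras"
begin

text \<open>
  Suppose the conclusion fails on a non-null set. Up to a null set it is a countable union of sets
  \<open>A\<close> on which, at all scales below a fixed \<open>\<delta>\<close>, doubling holds and the cones of aperture \<open>\<alpha>\<close>
  carry less than a \<open>c\<close>-fraction of the ball. If \<open>y \<in> A\<close> lay in the cone of aperture \<open>\<alpha> / 2\<close> at a
  point \<open>x \<in> A\<close> with \<open>\<rho> = |y - x|\<close> small, then the ball of radius \<open>\<alpha> \<rho> / 4\<close> around \<open>y\<close> would lie
  in the cone of aperture \<open>\<alpha>\<close> at \<open>x\<close>, and doubling at \<open>y\<close> would give that cone a fixed fraction of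
  the mass of the ball of radius \<open>2 \<rho>\<close> around \<open>x\<close>. So the narrow cones at points of \<open>A\<close> contain
  no nearby points of \<open>A\<close>; hence \<open>A\<close> is covered by countably many Lipschitz graphs over a
  complement of \<open>V\<close>, and it is null because the measure is purely unrectifiable.
\<close>

section \<open>Euclidean distance\<close>

lemma edist_L2_set: "edist n x y = L2_set (\<lambda>i. x i - y i) {..<n}"
  by (simp add: edist_def L2_set_def)

lemma edist_nonneg [simp]: "0 \<le> edist n x y"
  by (simp add: edist_L2_set)

lemma edist_self [simp]: "edist n x x = 0"
  by (simp add: edist_def)

lemma edist_commute: "edist n x y = edist n y x"
  by (simp add: edist_def power2_commute)

lemma edist_triangle: "edist n x z \<le> edist n x y + edist n y z"
  using L2_set_triangle_ineq[of "\<lambda>i. x i - y i" "\<lambda>i. y i - z i" "{..<n}"]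
  by (simp add: edist_L2_set)

lemma edist_le_sum: "edist n x y \<le> (\<Sum>i<n. \<bar>x i - y i\<bar>)"
  by (simp add: edist_L2_set L2_set_le_sum_abs)

lemma abs_le_edist: "i < n \<Longrightarrow> \<bar>x i - y i\<bar> \<le> edist n x y"
  unfolding edist_def by (intro real_le_rsqrt) (auto intro!: member_le_sum)

lemma edist_le_mult:
  assumes "\<And>i. i < n \<Longrightarrow> \<bar>x i - y i\<bar> \<le> B"
  shows "edist n x y \<le> n * B"
  using edist_le_sum[of n x y] sum_bounded_above[of "{..<n}" "\<lambda>i. \<bar>x i - y i\<bar>" B] assms
  by simp

text \<open>Rounding coordinates down on a grid of mesh \<open>1 / N\<close> cuts space into
  countably many small cells, which \<open>h\<close> numbers. Arguments valid only at small
  distances can then be run cell by cell.\<close>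

lemma ex_small_cells:
  assumes "\<delta> > 0"
  obtains h :: "(nat \<Rightarrow> real) \<Rightarrow> nat" where "\<And>x y. h x = h y \<Longrightarrow> edist n x y < \<delta>"
proof -
  \<comment> \<open>Bounding the distance by the sum of the coordinate differences costs a factor
    \<open>n\<close>, which \<open>N\<close> has to absorb.\<close>
  obtain N :: nat where N: "real n / \<delta> < N" using reals_Archimedean2 by blast
  have "N > 0"
    using N assms by (cases "N = 0") (auto simp: not_less divide_less_0_iff)
  have N': "n * (1 / N) < \<delta>"
    using N assms \<open>N > 0\<close> by (simp add: field_simps)
  define h where "h x = to_nat (map (\<lambda>i. \<lfloor>x i * N\<rfloor>) [0..<n])" for x :: "nat \<Rightarrow> real"
  have "edist n x y < \<delta>" if "h x = h y" for x y
  proof -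
    have "\<bar>x i - y i\<bar> \<le> 1 / N" if "i < n" for i
    proof -
      have "\<lfloor>x i * N\<rfloor> = \<lfloor>y i * N\<rfloor>"
        using \<open>h x = h y\<close> \<open>i < n\<close> by (simp add: h_def)
      then have "\<bar>x i * N - y i * N\<bar> \<le> 1" by linarith
      then have "\<bar>x i - y i\<bar> * N \<le> 1"
        using \<open>N > 0\<close> by (simp add: abs_mult flip: left_diff_distrib)
      then show ?thesis using \<open>N > 0\<close> by (simp add: field_simps)
    qed
    then have "edist n x y \<le> n * (1 / N)" by (rule edist_le_mult)
    with N' show ?thesis by linarith
  qed
  with that show ?thesis .
qed

section \<open>Distance to a subspace\<close>

lemma setdist_e_le: "v \<in> V \<Longrightarrow> setdist_e n z V \<le> edist n z v"
  unfolding setdist_e_def by (rule cInf_lower) (auto intro!: bdd_belowI[of _ 0])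

lemma setdist_e_triangle:
  assumes "V \<noteq> {}"
  shows "setdist_e n z V \<le> setdist_e n z' V + edist n z z'"
proof -
  have "setdist_e n z V - edist n z z' \<le> setdist_e n z' V"
    unfolding setdist_e_def[of n z']
  proof (rule cInf_greatest)
    fix e assume "e \<in> {edist n z' v |v. v \<in> V}"
    then obtain v where v: "v \<in> V" "e = edist n z' v" by blast
    show "setdist_e n z V - edist n z z' \<le> e"
      using setdist_e_le[OF v(1), of n z] edist_triangle[of n z v z'] v(2) by linarith
  qed (use assms in blast)
  then show ?thesis by linarith
qed

lemma grass_nonempty: "grass n k V \<Longrightarrow> V \<noteq> {}"
  unfolding grass_def by blast

lemma grass_diff:
  assumes "grass n k V" "u \<in> V" "v \<in> V"
  shows "(\<lambda>i. u i - v i) \<in> V"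
proof -
  from assms obtain b s t where V: "V = {(\<lambda>i. \<Sum>j<k. t j * b j i) | t. True}"
    and "u = (\<lambda>i. \<Sum>j<k. s j * b j i)" "v = (\<lambda>i. \<Sum>j<k. t j * b j i)"
    unfolding grass_def by blast
  then have "(\<lambda>i. u i - v i) = (\<lambda>i. \<Sum>j<k. (s j - t j) * b j i)"
    by (simp add: left_diff_distrib sum_subtractf)
  then show ?thesis
    unfolding V by (intro CollectI exI[of _ "\<lambda>j. s j - t j"]) simp
qed

lemma sum_fun_apply: "(\<Sum>a\<in>A. f a) x = (\<Sum>a\<in>A. f a x :: 'b :: comm_monoid_add)"
  by (induction A rule: infinite_finite_induct) auto

text \<open>Extending a basis of \<open>V\<close> to a basis of \<open>RR n\<close> adds at most
  \<open>n - k\<close> vectors; \<open>w\<close> enumerates them, and they span a complement of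
  \<open>V\<close>.\<close>

lemma grass_complement:
  assumes "grass n k V"
  obtains w :: "nat \<Rightarrow> nat \<Rightarrow> real"
  where "\<And>x. x \<in> RR n \<Longrightarrow> \<exists>t. (\<lambda>i. x i - (\<Sum>j<n-k. t j * w j i)) \<in> V"
proof -
  \<comment> \<open>Pointwise scaling makes these functions a vector space, so that basis extension
    and the size bound for independent sets apply.\<close>
  define sc where "sc = (\<lambda>c (f :: nat \<Rightarrow> real) i. c * f i)"
  interpret vs: vector_space sc
    by unfold_locales (auto simp: sc_def algebra_simps)
  from assms obtain b :: "nat \<Rightarrow> nat \<Rightarrow> real" where bR: "\<And>j. j < k \<Longrightarrow> b j \<in> RR n"
    and ind: "\<And>t. (\<And>i. (\<Sum>j<k. t j * b j i) = 0) \<Longrightarrow> \<forall>j<k. t j = 0"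
    and V: "V = {(\<lambda>i. \<Sum>j<k. t j * b j i) | t. True}"
    unfolding grass_def by blast
  \<comment> \<open>An independent family has no repetitions: equal vectors at
    \<open>p \<noteq> q\<close> satisfy the relation with coefficients 1 and -1. Hence the set
    \<open>S\<close> below has exactly \<open>k\<close> elements.\<close>
  have inj: "inj_on b {..<k}"
  proof (rule inj_onI, rule ccontr)
    fix p q assume pq: "p \<in> {..<k}" "q \<in> {..<k}" "b p = b q" "p \<noteq> q"
    define t :: "nat \<Rightarrow> real" where "t j = of_bool (j = p) - of_bool (j = q)" for j
    have "(\<Sum>j<k. t j * b j i) = 0" for i
    proof -
      have "(\<Sum>j<k. t j * b j i) = (\<Sum>j<k. of_bool (j = p) * b j i) - (\<Sum>j<k. of_bool (j = q) * b j i)"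
        by (simp add: t_def left_diff_distrib sum_subtractf)
      also have "\<dots> = b p i - b q i"
        using pq by (simp add: of_bool_def if_distrib[of "\<lambda>x. x * _"] cong: if_cong)
      finally show ?thesis using pq by simp
    qed
    from ind[OF this] pq show False by (auto simp: t_def)
  qed
  define S where "S = b ` {..<k}"
  have [simp]: "finite S" "card S = k"
    using inj by (auto simp: S_def card_image)
  have S_sum: "(\<Sum>v\<in>S. sc (u v) v) i = (\<Sum>j<k. u (b j) * b j i)" for u i
    by (simp add: S_def sum_fun_apply sc_def sum.reindex[OF inj])
  have S_ind: "vs.independent S"
  proof
    assume "vs.dependent S"
    then obtain u where u: "\<exists>v\<in>S. u v \<noteq> 0" "(\<Sum>v\<in>S. sc (u v) v) = 0"
      by (auto simp: vs.dependent_finite)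
    have "\<forall>j<k. u (b j) = 0"
      by (rule ind) (simp add: S_sum[symmetric] u)
    then show False using u(1) by (auto simp: S_def)
  qed
  obtain B where B: "S \<subseteq> B" "B \<subseteq> RR n" "vs.independent B" "RR n \<subseteq> vs.span B"
    using vs.maximal_independent_subset_extend[of S "RR n"] S_ind bR by (auto simp: S_def)
  \<comment> \<open>The standard unit vectors span \<open>RR n\<close>, so the independent set
    \<open>B\<close> is finite with at most \<open>n\<close> elements.\<close>
  define E where "E = (\<lambda>j (i::nat). of_bool (i = j) :: real) ` {..<n}"
  have "RR n \<subseteq> vs.span E"
  proof
    fix x :: "nat \<Rightarrow> real" assume x: "x \<in> RR n"
    have "x i = (\<Sum>j<n. sc (x j) (\<lambda>i. of_bool (i = j))) i" for i
      using x by (auto simp: sum_fun_apply sc_def RR_def of_bool_def if_distrib[of "\<lambda>x. _ * x"] cong: if_cong)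
    then have "x = (\<Sum>j<n. sc (x j) (\<lambda>i. of_bool (i = j)))" by blast
    also have "\<dots> \<in> vs.span E"
      by (intro vs.span_sum vs.span_scale vs.span_base) (auto simp: E_def)
    finally show "x \<in> vs.span E" .
  qed
  then have "finite B \<and> card B \<le> card E"
    using B by (intro vs.independent_span_bound) (auto simp: E_def)
  moreover have "card E \<le> n"
    unfolding E_def using card_image_le[of "{..<n}"] by simp
  ultimately have "finite B" "card B \<le> n" by auto
  define l where "l = card (B - S)"
  have l: "l \<le> n - k"
    using \<open>card B \<le> n\<close> \<open>S \<subseteq> B\<close> \<open>finite B\<close> by (simp add: l_def card_Diff_subset)
  obtain w where w: "bij_betw w {0..<l} (B - S)"
    unfolding l_def using ex_bij_betw_nat_finite \<open>finite B\<close> by blast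
  show thesis
  proof (rule that[of w])
    fix x assume "x \<in> RR n"
    then obtain u where u: "x = (\<Sum>v\<in>B. sc (u v) v)"
      using B(4) \<open>finite B\<close> by (auto simp: vs.span_finite)
    \<comment> \<open>Only \<open>l \<le> n - k\<close> is known, so the coefficients are padded
      with zeros where \<open>w j\<close> is arbitrary.\<close>
    define t where "t j = (if j < l then u (w j) else 0)" for j
    have "x i - (\<Sum>j<n-k. t j * w j i) = (\<Sum>j<k. u (b j) * b j i)" for i
    proof -
      have "x i = (\<Sum>v\<in>B. sc (u v) v i)"
        unfolding u by (rule sum_fun_apply)
      also have "\<dots> = (\<Sum>v\<in>S. sc (u v) v i) + (\<Sum>v\<in>B - S. sc (u v) v i)"
        using B(1) \<open>finite B\<close> by (subst add.commute) (rule sum.subset_diff)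
      also have "(\<Sum>v\<in>B - S. sc (u v) v i) = (\<Sum>j\<in>{0..<l}. sc (u (w j)) (w j) i)"
        by (rule sum.reindex_bij_betw[OF w, symmetric])
      also have "\<dots> = (\<Sum>j<n-k. t j * w j i)"
        using l by (intro sum.mono_neutral_cong_left) (auto simp: t_def sc_def)
      finally show ?thesis
        using S_sum[of u i] by (simp add: sum_fun_apply)
    qed
    then have "(\<lambda>i. x i - (\<Sum>j<n-k. t j * w j i)) \<in> V"
      unfolding V by (intro CollectI exI[of _ "\<lambda>j. u (b j)"]) simp
    then show "\<exists>t. (\<lambda>i. x i - (\<Sum>j<n-k. t j * w j i)) \<in> V" by blast
  qed
qed

text \<open>\<open>P\<close> records coefficients along a complement of \<open>V\<close>; any choice
  of them will do. The \<open>V\<close>-parts of \<open>x\<close> and \<open>y\<close> differ by an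
  element \<open>v\<close> of \<open>V\<close>, so the distance of \<open>y - x\<close> from
  \<open>V\<close> is at most the length of \<open>y - x - v\<close>, which the coefficients
  control.\<close>

lemma grass_coordinates:
  assumes V: "grass n k V"
  obtains P C where "C \<ge> 0" "P ` RR n \<subseteq> RR (n - k)"
    "\<And>x y. x \<in> RR n \<Longrightarrow> y \<in> RR n \<Longrightarrow>
      setdist_e n (\<lambda>i. y i - x i) V \<le> C * edist (n - k) (P x) (P y)"
proof -
  define m where "m = n - k"
  obtain w :: "nat \<Rightarrow> nat \<Rightarrow> real"
    where w: "\<And>x. x \<in> RR n \<Longrightarrow> \<exists>t. (\<lambda>i. x i - (\<Sum>j<m. t j * w j i)) \<in> V"
    unfolding m_def using grass_complement[OF V] by blast
  from w obtain t where t: "\<And>x. x \<in> RR n \<Longrightarrow> (\<lambda>i. x i - (\<Sum>j<m. t x j * w j i)) \<in> V"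
    by metis
  define P where "P x = (\<lambda>j. if j < m then t x j else 0)" for x
  define C where "C = (\<Sum>i<n. \<Sum>j<m. \<bar>w j i\<bar>)"
  show thesis
  proof (rule that[of C P])
    show "C \<ge> 0" by (simp add: C_def sum_nonneg)
    show "P ` RR n \<subseteq> RR (n - k)" by (auto simp: P_def RR_def m_def)
    fix x y assume xy: "x \<in> RR n" "y \<in> RR n"
    define v where "v = (\<lambda>i. (y i - (\<Sum>j<m. t y j * w j i)) - (x i - (\<Sum>j<m. t x j * w j i)))"
    have "v \<in> V"
      unfolding v_def by (rule grass_diff[OF V]) (use t xy in auto)
    then have "setdist_e n (\<lambda>i. y i - x i) V \<le> edist n (\<lambda>i. y i - x i) v"
      by (rule setdist_e_le)
    also have "\<dots> \<le> (\<Sum>i<n. \<bar>(y i - x i) - v i\<bar>)"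
      by (rule edist_le_sum)
    also have "\<dots> \<le> (\<Sum>i<n. \<Sum>j<m. \<bar>w j i\<bar> * edist m (P x) (P y))"
    proof (rule sum_mono)
      fix i
      have "\<bar>(y i - x i) - v i\<bar> = \<bar>\<Sum>j<m. w j i * (P y j - P x j)\<bar>"
        by (simp add: v_def P_def right_diff_distrib sum_subtractf mult.commute)
      also have "\<dots> \<le> (\<Sum>j<m. \<bar>w j i\<bar> * \<bar>P x j - P y j\<bar>)"
        by (rule order_trans[OF sum_abs]) (simp add: abs_mult abs_minus_commute)
      also have "\<dots> \<le> (\<Sum>j<m. \<bar>w j i\<bar> * edist m (P x) (P y))"
        by (intro sum_mono mult_left_mono abs_le_edist) auto
      finally show "\<bar>(y i - x i) - v i\<bar> \<le> (\<Sum>j<m. \<bar>w j i\<bar> * edist m (P x) (P y))" .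
    qed
    also have "\<dots> = C * edist (n - k) (P x) (P y)"
      by (simp add: C_def sum_distrib_right m_def)
    finally show "setdist_e n (\<lambda>i. y i - x i) V \<le> C * edist (n - k) (P x) (P y)" .
  qed
qed

section \<open>Rectifiability of sets missing a cone\<close>

text \<open>McShane's extension: the hypothesis makes \<open>g x\<close> a Lipschitz function of
  \<open>P x\<close>, and an infimum of \<open>L\<close>-Lipschitz functions of \<open>u\<close>
  extends it to every \<open>u\<close>.\<close>

lemma lipschitz_extension_real:
  fixes g :: "'a \<Rightarrow> real"
  assumes "E \<noteq> {}" "L \<ge> 0"
    and g: "\<And>x y. x \<in> E \<Longrightarrow> y \<in> E \<Longrightarrow> g x - g y \<le> L * edist m (P x) (P y)"
  obtains G where "\<And>x. x \<in> E \<Longrightarrow> G (P x) = g x" "\<And>u v. \<bar>G u - G v\<bar> \<le> L * edist m u v"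
proof -
  define G where "G u = (INF x\<in>E. g x + L * edist m u (P x))" for u
  obtain a where a: "a \<in> E" using assms by blast
  have bdd: "bdd_below ((\<lambda>x. g x + L * edist m u (P x)) ` E)" for u
  proof (rule bdd_belowI2)
    fix x assume "x \<in> E"
    have "g a - g x \<le> L * edist m (P a) (P x)"
      using g a \<open>x \<in> E\<close> by blast
    also have "\<dots> \<le> L * (edist m (P a) u + edist m u (P x))"
      using assms by (intro mult_left_mono edist_triangle)
    finally show "g a - L * edist m (P a) u \<le> g x + L * edist m u (P x)"
      by (simp add: algebra_simps)
  qed
  have le: "G u - L * edist m u v \<le> G v" for u v
    unfolding G_def[of v]
  proof (rule cINF_greatest)
    fix x assume "x \<in> E"
    then have "G u \<le> g x + L * edist m u (P x)"
      unfolding G_def by (intro cINF_lower bdd)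
    also have "\<dots> \<le> g x + L * (edist m u v + edist m v (P x))"
      using assms by (intro add_left_mono mult_left_mono edist_triangle)
    finally show "G u - L * edist m u v \<le> g x + L * edist m v (P x)"
      by (simp add: algebra_simps)
  qed (use assms in auto)
  show thesis
  proof (rule that[of G])
    fix x assume x: "x \<in> E"
    show "G (P x) = g x"
    proof (rule antisym)
      show "G (P x) \<le> g x"
        unfolding G_def using cINF_lower[OF bdd x, of "P x"] by simp
      show "g x \<le> G (P x)"
        unfolding G_def using assms(1) g[OF x] by (intro cINF_greatest) (auto simp: algebra_simps)
    qed
  next
    fix u v
    show "\<bar>G u - G v\<bar> \<le> L * edist m u v"
      using le[of u v] le[of v u] by (simp add: edist_commute[of m v u] abs_le_iff)
  qed
qed

text \<open>The bound by \<open>L\<close> makes \<open>P\<close> injective on \<open>E\<close> with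
  Lipschitz inverse. The map \<open>f\<close> extends this inverse one coordinate at a time, at the
  cost of a factor \<open>n\<close> in the Lipschitz constant.\<close>

lemma lipschitz_cover:
  assumes E: "E \<subseteq> RR n" and P: "P ` E \<subseteq> RR m" and "L \<ge> 0"
    and L: "\<And>x y. x \<in> E \<Longrightarrow> y \<in> E \<Longrightarrow> edist n x y \<le> L * edist m (P x) (P y)"
  shows "\<exists>f. lipschitz_e m n f \<and> E \<subseteq> f ` RR m"
proof (cases "E = {}")
  case True
  \<comment> \<open>The extension needs a nonempty domain, so here a constant map serves.\<close>
  have "lipschitz_e m n (\<lambda>u i. 0)"
    unfolding lipschitz_e_def by (intro conjI exI[of _ 0]) (auto simp: RR_def)
  then show ?thesis using True by blast
next
  case False
  have "\<exists>G. (\<forall>x\<in>E. G (P x) = x i) \<and> (\<forall>u v. \<bar>G u - G v\<bar> \<le> L * edist m u v)" if "i < n" for i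
  proof -
    have "x i - y i \<le> L * edist m (P x) (P y)" if "x \<in> E" "y \<in> E" for x y
      using abs_le_edist[OF \<open>i < n\<close>, of x y] L[OF that] by linarith
    then show ?thesis
      by (rule lipschitz_extension_real[OF False \<open>L \<ge> 0\<close>]) auto
  qed
  then obtain G where G: "\<And>i x. i < n \<Longrightarrow> x \<in> E \<Longrightarrow> G i (P x) = x i"
    and G_lip: "\<And>i u v. i < n \<Longrightarrow> \<bar>G i u - G i v\<bar> \<le> L * edist m u v"
    by metis
  define f where "f u = (\<lambda>i. if i < n then G i u else 0)" for u
  have "edist n (f u) (f v) \<le> n * (L * edist m u v)" for u v
    by (rule edist_le_mult) (simp add: f_def G_lip)
  then have "lipschitz_e m n f"
    unfolding lipschitz_e_def
    by (intro conjI exI[of _ "n * L"]) (auto simp: RR_def f_def mult.assoc)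
  moreover have "f (P x) = x" if "x \<in> E" for x
    using that E by (auto simp: f_def G RR_def fun_eq_iff subset_iff)
  then have "E \<subseteq> f ` RR m"
    using P by (metis image_eqI image_subset_iff subsetI)
  ultimately show ?thesis by blast
qed

text \<open>Empty sets form a cover. The bound \<open>m \<ge> 1\<close> matters: with
  \<open>0 ^ 0 = 1\<close> each of them would have positive weight.\<close>

lemma hausdorff_empty: "m \<ge> 1 \<Longrightarrow> hausdorff n m {} = 0"
proof -
  assume "m \<ge> 1"
  have "hausdorff_delta n m \<delta> {} \<le> 0" for \<delta>
    unfolding hausdorff_delta_def
  proof (rule INF_lower2)
    show "(\<lambda>_. {}) \<in> {C. (\<forall>i. C i \<subseteq> RR n \<and> ediam n (C i) \<le> ennreal \<delta>) \<and> {} \<subseteq> (\<Union>i. C i)}"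
      by (simp add: ediam_def bot_ennreal)
  qed (use \<open>m \<ge> 1\<close> in \<open>simp add: ediam_def bot_ennreal power_0_left\<close>)
  then have "hausdorff n m {} \<le> 0"
    unfolding hausdorff_def by (intro SUP_least)
  then show ?thesis by simp
qed

text \<open>For \<open>y\<close> outside the cone at \<open>x\<close>, \<open>\<beta>\<close> times
  the distance of \<open>x\<close> and \<open>y\<close> is at most the distance of
  \<open>y - x\<close> from \<open>V\<close>, hence at most \<open>C\<close> times that of
  \<open>P x\<close> and \<open>P y\<close>. So \<open>P\<close> has a Lipschitz inverse on each
  small cell, and countably many Lipschitz images cover \<open>A\<close> entirely.\<close>

lemma rectifiable_avoid_cone:
  assumes V: "grass n (n - m) V" and "1 \<le> m" "m < n" and A: "A \<subseteq> RR n"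
    and "\<beta> > 0" "\<delta> > 0"
    and avoid: "\<And>x y. x \<in> A \<Longrightarrow> y \<in> A \<Longrightarrow> edist n y x < \<delta> \<Longrightarrow> y \<notin> cone n x V \<beta>"
  shows "rectifiable n m A"
proof -
  have m: "n - (n - m) = m" using \<open>m < n\<close> by simp
  obtain P C where "C \<ge> 0" and P: "P ` RR n \<subseteq> RR m"
    and C: "\<And>x y. x \<in> RR n \<Longrightarrow> y \<in> RR n \<Longrightarrow>
      setdist_e n (\<lambda>i. y i - x i) V \<le> C * edist m (P x) (P y)"
    using grass_coordinates[OF V] unfolding m by metis
  obtain h :: "(nat \<Rightarrow> real) \<Rightarrow> nat" where h: "\<And>x y. h x = h y \<Longrightarrow> edist n x y < \<delta>"
    using ex_small_cells[OF \<open>\<delta> > 0\<close>] by metis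
  have "\<exists>f. lipschitz_e m n f \<and> {x \<in> A. h x = k} \<subseteq> f ` RR m" for k
  proof (rule lipschitz_cover[where L = "C / \<beta>"])
    fix x y assume xy: "x \<in> {x \<in> A. h x = k}" "y \<in> {x \<in> A. h x = k}"
    have "y \<notin> cone n x V \<beta>"
      using xy h[of y x] by (intro avoid) auto
    moreover have "x \<in> RR n" "y \<in> RR n" using xy A by auto
    ultimately have "\<beta> * edist n y x \<le> C * edist m (P x) (P y)"
      using C[of x y] by (auto simp: cone_def)
    then show "edist n x y \<le> C / \<beta> * edist m (P x) (P y)"
      using \<open>\<beta> > 0\<close> by (simp add: field_simps edist_commute[of n y x])
  qed (use A P \<open>C \<ge> 0\<close> \<open>\<beta> > 0\<close> in auto)
  then obtain f where f: "\<And>k. lipschitz_e m n (f k)" "\<And>k. {x \<in> A. h x = k} \<subseteq> f k ` RR m"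
    by metis
  have "A - (\<Union>k. f k ` RR m) = {}"
    using f(2) by blast
  then have "hausdorff n m (A - (\<Union>k. f k ` RR m)) = 0"
    using hausdorff_empty[OF \<open>1 \<le> m\<close>] by (simp only:)
  then show ?thesis
    unfolding rectifiable_def using A f(1) by blast
qed

section \<open>Null sets\<close>

lemma is_measure_mono: "is_measure n \<mu> \<Longrightarrow> A \<subseteq> B \<Longrightarrow> B \<subseteq> RR n \<Longrightarrow> \<mu> A \<le> \<mu> B"
  by (simp add: is_measure_def)

lemma is_measure_null_subset:
  "is_measure n \<mu> \<Longrightarrow> A \<subseteq> B \<Longrightarrow> B \<subseteq> RR n \<Longrightarrow> \<mu> B = 0 \<Longrightarrow> \<mu> A = 0"
  using is_measure_mono[of n \<mu> A B] by simp

lemma is_measure_null_UN: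
  fixes A :: "nat \<Rightarrow> (nat \<Rightarrow> real) set"
  assumes "is_measure n \<mu>" "\<And>i. A i \<subseteq> RR n" "\<And>i. \<mu> (A i) = 0"
  shows "\<mu> (\<Union>i. A i) = 0"
proof -
  have "\<mu> (\<Union>i. A i) \<le> (\<Sum>i. \<mu> (A i))"
    using assms(1,2) by (simp add: is_measure_def)
  then show ?thesis using assms(3) by simp
qed

lemma is_measure_null_Un:
  assumes "is_measure n \<mu>" "A \<subseteq> RR n" "B \<subseteq> RR n" "\<mu> A = 0" "\<mu> B = 0"
  shows "\<mu> (A \<union> B) = 0"
proof -
  have "A \<union> B = (\<Union>i::nat. if i = 0 then A else B)"
    unfolding set_eq_iff Un_iff UN_iff by (metis UNIV_I zero_neq_one)
  then show ?thesis
    using is_measure_null_UN[OF assms(1), of "\<lambda>i. if i = 0 then A else B"] assms by simp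
qed

text \<open>This excludes zero denominators. Points whose balls of radius
  \<open>inverse (Suc k)\<close> are null fall into countably many cells, and each cell lies in such
  a null ball about any one of its points.\<close>

lemma ae_e_support:
  assumes \<mu>: "is_measure n \<mu>"
  shows "ae_e n \<mu> (\<lambda>x. \<forall>r>0. \<mu> (cb n x r) > 0)"
proof -
  define N where "N k = {x \<in> RR n. \<mu> (cb n x (inverse (Suc k))) = 0}" for k
  have null: "\<mu> (N k) = 0" for k
  proof -
    obtain h :: "(nat \<Rightarrow> real) \<Rightarrow> nat"
      where h: "\<And>x y. h x = h y \<Longrightarrow> edist n x y < inverse (Suc k)"
      by (rule ex_small_cells[of "inverse (Suc k)" n]) auto
    have "\<mu> {x \<in> N k. h x = j} = 0" for j
    proof (cases "{x \<in> N k. h x = j} = {}")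
      case True
      then show ?thesis using \<mu> by (simp only: is_measure_def)
    next
      case False
      then obtain a where a: "a \<in> N k" "h a = j" by blast
      have "{x \<in> N k. h x = j} \<subseteq> cb n a (inverse (Suc k))"
      proof
        fix x assume "x \<in> {x \<in> N k. h x = j}"
        then have "x \<in> RR n" "edist n a x < inverse (Suc k)"
          using h[of a x] a(2) by (simp_all add: N_def)
        then show "x \<in> cb n a (inverse (Suc k))" by (simp add: cb_def)
      qed
      then show ?thesis
        by (rule is_measure_null_subset[OF \<mu>]) (use a in \<open>auto simp: cb_def N_def\<close>)
    qed
    then have "\<mu> (\<Union>j. {x \<in> N k. h x = j}) = 0"
      by (intro is_measure_null_UN[OF \<mu>]) (auto simp: N_def)
    moreover have "(\<Union>j. {x \<in> N k. h x = j}) = N k" by blast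
    ultimately show ?thesis by simp
  qed
  have "{x \<in> RR n. \<not> (\<forall>r>0. \<mu> (cb n x r) > 0)} \<subseteq> (\<Union>k. N k)"
  proof
    fix x assume "x \<in> {x \<in> RR n. \<not> (\<forall>r>0. \<mu> (cb n x r) > 0)}"
    then obtain r where r: "x \<in> RR n" "r > 0" "\<mu> (cb n x r) = 0" by (auto simp: not_less)
    obtain k where "inverse (Suc k) < r" using reals_Archimedean r(2) by blast
    then have "\<mu> (cb n x (inverse (Suc k))) = 0"
      by (intro is_measure_null_subset[OF \<mu> _ _ r(3)]) (auto simp: cb_def)
    then show "x \<in> (\<Union>k. N k)" using r by (auto simp: N_def)
  qed
  moreover have "\<mu> (\<Union>k. N k) = 0"
    using null by (intro is_measure_null_UN[OF \<mu>]) (auto simp: N_def)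
  moreover have "(\<Union>k. N k) \<subseteq> RR n" by (auto simp: N_def)
  ultimately show ?thesis
    unfolding ae_e_def using is_measure_null_subset[OF \<mu>] by blast
qed

section \<open>Doubling and cones\<close>

text \<open>Halving the aperture leaves room: for \<open>z\<close> in the small ball the distance of
  \<open>z - x\<close> from \<open>V\<close> stays below \<open>3/4 * \<alpha> * \<rho>\<close>,
  while \<open>z\<close> is at least \<open>3/4 * \<rho>\<close> away from \<open>x\<close>.\<close>

lemma cb_subset_cone_ball:
  assumes "V \<noteq> {}" "0 < \<alpha>" "\<alpha> \<le> 1" and y: "y \<in> cone n x V (\<alpha> / 2)"
  defines "\<rho> \<equiv> edist n y x"
  shows "cb n y (\<alpha> / 4 * \<rho>) \<subseteq> cone_ball n x (2 * \<rho>) V \<alpha>"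
proof
  fix z assume z: "z \<in> cb n y (\<alpha> / 4 * \<rho>)"
  have dy: "setdist_e n (\<lambda>i. y i - x i) V < \<alpha> / 2 * \<rho>"
    using y by (simp add: cone_def \<rho>_def)
  have zy: "edist n y z \<le> \<alpha> / 4 * \<rho>"
    using z by (simp add: cb_def)
  have "\<rho> \<ge> 0" by (simp add: \<rho>_def)
  have \<alpha>\<rho>: "\<alpha> * \<rho> \<le> \<rho>" using mult_right_mono[OF \<open>\<alpha> \<le> 1\<close> \<open>\<rho> \<ge> 0\<close>] by simp
  have "edist n (\<lambda>i. z i - x i) (\<lambda>i. y i - x i) = edist n y z"
    by (simp add: edist_def power2_commute)
  then have "setdist_e n (\<lambda>i. z i - x i) V < \<alpha> / 2 * \<rho> + \<alpha> / 4 * \<rho>"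
    using setdist_e_triangle[OF \<open>V \<noteq> {}\<close>, of n "\<lambda>i. z i - x i" "\<lambda>i. y i - x i"] dy zy by linarith
  also have "\<dots> \<le> \<alpha> * (\<rho> - \<alpha> / 4 * \<rho>)"
  proof -
    have "\<alpha> * (\<rho> - \<alpha> / 4 * \<rho>) = \<alpha> * \<rho> - \<alpha> * (\<alpha> * \<rho>) / 4" by (simp add: algebra_simps)
    moreover have "\<alpha> * (\<alpha> * \<rho>) \<le> \<alpha> * \<rho>" using \<alpha>\<rho> \<open>0 < \<alpha>\<close> by (intro mult_left_mono) auto
    ultimately show ?thesis by linarith
  qed
  also have "\<dots> \<le> \<alpha> * edist n z x"
    using edist_triangle[of n y x z] zy \<open>0 < \<alpha>\<close> by (intro mult_left_mono) (auto simp: \<rho>_def)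
  finally have "z \<in> cone n x V \<alpha>"
    using z by (simp add: cone_def cb_def)
  moreover have "edist n x z \<le> 2 * \<rho>"
    using edist_triangle[of n x z y] zy \<alpha>\<rho> \<open>\<rho> \<ge> 0\<close>
    unfolding edist_commute[of n x y] \<rho>_def[symmetric] by linarith
  ultimately show "z \<in> cone_ball n x (2 * \<rho>) V \<alpha>"
    using z by (simp add: cone_ball_def cb_def)
qed

lemma doubling_iterate:
  fixes D :: ennreal
  assumes "\<And>r. 0 < r \<Longrightarrow> r < \<delta> \<Longrightarrow> \<mu> (cb n y (2 * r)) \<le> D * \<mu> (cb n y r)"
    and "0 < s" "2 ^ k * s \<le> \<delta>"
  shows "\<mu> (cb n y (2 ^ k * s)) \<le> D ^ k * \<mu> (cb n y s)"
  using assms(3)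
proof (induction k)
  case (Suc k)
  \<comment> \<open>Doubling is applied at half the final radius, so it stays strictly below
    \<open>\<delta>\<close> even if the final radius equals \<open>\<delta>\<close>.\<close>
  have "0 < 2 ^ k * s" using \<open>0 < s\<close> by simp
  moreover have "2 * (2 ^ k * s) \<le> \<delta>" using Suc.prems by simp
  ultimately have s: "0 < 2 ^ k * s" "2 ^ k * s < \<delta>" by linarith+
  have "\<mu> (cb n y (2 * (2 ^ k * s))) \<le> D * \<mu> (cb n y (2 ^ k * s))"
    using s by (rule assms(1))
  also have "\<dots> \<le> D * (D ^ k * \<mu> (cb n y s))"
    using s Suc.IH by (intro mult_left_mono) auto
  finally show ?case by (simp add: mult.assoc)
qed simp

text \<open>The ball of radius \<open>2 * \<rho>\<close> about \<open>x\<close> lies in that of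
  radius \<open>3 * \<rho>\<close> about \<open>y\<close>. By the choice of \<open>k\<close>, at
  most \<open>k\<close> halvings bring \<open>3 * \<rho>\<close> down to
  \<open>\<alpha> / 4 * \<rho>\<close>, where the ball about \<open>y\<close> fits into the cone;
  hence the constant 12.\<close>

lemma cone_ball_mass:
  fixes D :: ennreal
  assumes \<mu>: "is_measure n \<mu>" and "V \<noteq> {}" "0 < \<alpha>" "\<alpha> \<le> 1"
    and xy: "x \<in> RR n" "y \<in> cone n x V (\<alpha> / 2)"
    and dbl: "\<And>r. 0 < r \<Longrightarrow> r < \<delta> \<Longrightarrow> \<mu> (cb n y (2 * r)) \<le> D * \<mu> (cb n y r)"
    and k: "12 / \<alpha> \<le> 2 ^ k" "2 ^ k * edist n y x \<le> \<delta>" "0 < edist n y x"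
  shows "\<mu> (cb n x (2 * edist n y x)) \<le> D ^ k * \<mu> (cone_ball n x (2 * edist n y x) V \<alpha>)"
proof -
  define \<rho> where "\<rho> = edist n y x"
  have \<rho>: "\<rho> > 0" "2 ^ k * \<rho> \<le> \<delta>" using k by (simp_all add: \<rho>_def)
  define s where "s = \<alpha> / 4 * \<rho>"
  have s: "s > 0" "s \<le> \<rho>"
    using \<rho> \<open>0 < \<alpha>\<close> mult_right_mono[OF \<open>\<alpha> \<le> 1\<close>, of \<rho>] by (auto simp: s_def)
  have "3 * \<rho> \<le> 2 ^ k * s"
  proof -
    have "12 \<le> 2 ^ k * \<alpha>" using k(1) \<open>0 < \<alpha>\<close> by (simp add: field_simps)
    from mult_right_mono[OF this, of \<rho>] show ?thesis using \<rho> by (simp add: s_def)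
  qed
  moreover have "edist n y z \<le> \<rho> + edist n x z" for z
    using edist_triangle[of n y z x] by (simp add: \<rho>_def)
  ultimately have "edist n y z \<le> 2 ^ k * s" if "edist n x z \<le> 2 * \<rho>" for z
    using that by (smt (verit))
  then have "cb n x (2 * \<rho>) \<subseteq> cb n y (2 ^ k * s)"
    by (auto simp: cb_def)
  then have "\<mu> (cb n x (2 * \<rho>)) \<le> \<mu> (cb n y (2 ^ k * s))"
    by (intro is_measure_mono[OF \<mu>]) (auto simp: cb_def)
  also have "\<dots> \<le> D ^ k * \<mu> (cb n y s)"
  proof (rule doubling_iterate[OF dbl])
    show "2 ^ k * s \<le> \<delta>"
      using \<rho>(2) by (rule order_trans[OF mult_left_mono[OF s(2)], rotated]) simp
  qed (use s in auto)
  also have "\<dots> \<le> D ^ k * \<mu> (cone_ball n x (2 * \<rho>) V \<alpha>)"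
    unfolding s_def \<rho>_def
    by (intro mult_left_mono is_measure_mono[OF \<mu>] cb_subset_cone_ball assms)
      (auto simp: cone_ball_def cb_def)
  finally show ?thesis by (simp add: \<rho>_def)
qed

text \<open>The bounds are in product form to avoid the junk values \<open>0 / 0\<close> and \<open>\<infinity> / \<infinity>\<close> of
  \<^typ>\<open>ennreal\<close>.\<close>
lemma null_if_doubling_and_thin_cones:
  fixes D :: ennreal
  assumes \<mu>: "is_measure n \<mu>" and unrect: "purely_unrectifiable n m \<mu>"
    and V: "grass n (n - m) V" "1 \<le> m" "m < n" and \<alpha>: "0 < \<alpha>" "\<alpha> \<le> 1"
    and A: "A \<subseteq> RR n" and "\<delta> > 0" and k: "12 / \<alpha> \<le> 2 ^ k"
    and dbl: "\<And>y r. y \<in> A \<Longrightarrow> 0 < r \<Longrightarrow> r < \<delta> \<Longrightarrow> \<mu> (cb n y (2 * r)) \<le> D * \<mu> (cb n y r)"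
    and thin: "\<And>x r. x \<in> A \<Longrightarrow> 0 < r \<Longrightarrow> r < \<delta> \<Longrightarrow>
      D ^ k * \<mu> (cone_ball n x r V \<alpha>) < \<mu> (cb n x r)"
  shows "\<mu> A = 0"
proof -
  have "V \<noteq> {}" using grass_nonempty V(1) .
  have "2 \<le> 12 / \<alpha>" using \<alpha> by (simp add: field_simps)
  with k have k2: "(2::real) \<le> 2 ^ k" by linarith
  have "rectifiable n m A"
  \<comment> \<open>At distances below \<open>\<delta> / 2 ^ k\<close>, both the radius for thinness
    at \<open>x\<close> and the radii for doubling at \<open>y\<close> stay below
    \<open>\<delta>\<close>.\<close>
  proof (rule rectifiable_avoid_cone[OF V A, of "\<alpha> / 2" "\<delta> / 2 ^ k"])
    fix x y assume xy: "x \<in> A" "y \<in> A" and d: "edist n y x < \<delta> / 2 ^ k"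
    show "y \<notin> cone n x V (\<alpha> / 2)"
    proof
      assume y: "y \<in> cone n x V (\<alpha> / 2)"
      \<comment> \<open>The cone inequality is strict, so \<open>x\<close> is not in its own cone
        and the radius used below is positive.\<close>
      have "0 \<le> setdist_e n (\<lambda>i. y i - x i) V"
        unfolding setdist_e_def by (rule cInf_greatest) (use \<open>V \<noteq> {}\<close> in auto)
      also have "\<dots> < \<alpha> / 2 * edist n y x" using y by (simp add: cone_def)
      finally have pos: "0 < edist n y x" using \<alpha> by (simp add: zero_less_mult_iff)
      have d': "2 ^ k * edist n y x < \<delta>" using d by (simp add: field_simps)
      have "D ^ k * \<mu> (cone_ball n x (2 * edist n y x) V \<alpha>) < \<mu> (cb n x (2 * edist n y x))"
      proof (rule thin[OF xy(1)])
        show "2 * edist n y x < \<delta>"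
          using d' by (rule le_less_trans[OF mult_right_mono[OF k2], rotated]) simp
      qed (use pos in simp)
      moreover have "\<mu> (cb n x (2 * edist n y x)) \<le> D ^ k * \<mu> (cone_ball n x (2 * edist n y x) V \<alpha>)"
        using xy A y pos d' by (intro cone_ball_mass[OF \<mu> \<open>V \<noteq> {}\<close> \<alpha> _ _ dbl k]) auto
      ultimately show False by simp
    qed
  qed (use \<alpha> \<open>\<delta> > 0\<close> in auto)
  then show ?thesis using unrect by (simp add: purely_unrectifiable_def)
qed

section \<open>From limsups of quotients to bounds in product form\<close>

lemma ennreal_le_of_divide_less:
  fixes a b :: ennreal
  assumes "a / b < c" "c > 0"
  shows "a \<le> c * b"
proof (cases "b = 0 \<or> b = top")
  \<comment> \<open>For \<open>b = 0\<close> a quotient below \<open>c\<close> forces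
    \<open>a = 0\<close>; for \<open>b = top\<close> the right-hand side is \<open>top\<close>
    because \<open>c > 0\<close>.\<close>
  case True
  with assms show ?thesis by (auto simp: ennreal_mult_top split: if_splits)
next
  case False
  then have "a = a / b * b"
    by (metis ennreal_times_divide ennreal_divide_times mult.commute mult_divide_eq_ennreal)
  also have "\<dots> \<le> c * b" using assms by (intro mult_right_mono) auto
  finally show ?thesis .
qed

text \<open>The strict bound fails for \<open>a = b = 0\<close> and for \<open>a = b = top\<close>,
  where the quotient is 0; positivity and finiteness of \<open>b\<close> exclude these
  cases.\<close>

lemma ennreal_mult_less_of_divide_less:
  fixes a b :: ennreal
  assumes "a / b < ennreal (1 / K)" "K > 0" "b > 0" "b < top"
  shows "ennreal K * a < b"
proof (rule ccontr)
  assume "\<not> ennreal K * a < b"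
  then have "ennreal (1 / K) * b \<le> ennreal (1 / K) * (ennreal K * a)"
    by (intro mult_left_mono) auto
  also have "\<dots> = a"
    using \<open>K > 0\<close> by (simp add: mult.assoc[symmetric] flip: ennreal_mult)
  finally have "ennreal (1 / K) * b / b \<le> a / b" by (rule divide_right_mono_ennreal)
  then show False using assms by (simp add: mult_divide_eq_ennreal)
qed

theorem theorem5p1:
  fixes d \<alpha> :: real
  assumes "d > 0" and "0 < \<alpha>" and "\<alpha> \<le> 1"
  shows "\<exists>c>0. \<forall>(n::nat) (m::nat) V \<mu>.
     1 \<le> m \<and> m < n \<and> grass n (n - m) V \<and> is_measure n \<mu> \<and> purely_unrectifiable n m \<mu> \<and>
     ae_e n \<mu> (\<lambda>x. Limsup (at_right (0::real)) (\<lambda>r. \<mu> (cb n x (2 * r)) / \<mu> (cb n x r)) < ennreal d)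
     \<longrightarrow> ae_e n \<mu> (\<lambda>x. Limsup (at_right (0::real)) (\<lambda>r. \<mu> (cone_ball n x r V \<alpha>) / \<mu> (cb n x r)) \<ge> ennreal c)"
proof -
  obtain k where k: "12 / \<alpha> \<le> 2 ^ k"
    using real_arch_pow[of 2 "12 / \<alpha>"] less_imp_le by auto
  \<comment> \<open>The fraction of mass left after \<open>k\<close> doublings. Since
    \<open>k\<close> depends only on \<open>\<alpha>\<close>, \<open>c\<close> is fixed before
    \<open>n\<close>, \<open>m\<close>, \<open>V\<close> and \<open>\<mu>\<close>.\<close>
  define c where "c = 1 / d ^ k"
  have main: "ae_e n \<mu> (\<lambda>x. Limsup (at_right (0::real)) (\<lambda>r. \<mu> (cone_ball n x r V \<alpha>) / \<mu> (cb n x r)) \<ge> ennreal c)"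
    if V: "1 \<le> m" "m < n" "grass n (n - m) V" and \<mu>: "is_measure n \<mu>"
      and unrect: "purely_unrectifiable n m \<mu>"
      and ae: "ae_e n \<mu> (\<lambda>x. Limsup (at_right (0::real)) (\<lambda>r. \<mu> (cb n x (2 * r)) / \<mu> (cb n x r)) < ennreal d)"
    for n m V \<mu>
  proof -
    define bad where "bad = {x \<in> RR n. \<not> Limsup (at_right (0::real)) (\<lambda>r. \<mu> (cb n x (2 * r)) / \<mu> (cb n x r)) < ennreal d}
        \<union> {x \<in> RR n. \<not> (\<forall>r>0. \<mu> (cb n x r) > 0)}"
    \<comment> \<open>Countably many scales suffice, since a bound valid for all small radii holds
      below some \<open>inverse (Suc j)\<close>.\<close>
    define A where "A j = {x \<in> RR n. \<forall>r. 0 < r \<longrightarrow> r < inverse (Suc j) \<longrightarrow>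
        \<mu> (cb n x (2 * r)) \<le> ennreal d * \<mu> (cb n x r) \<and>
        ennreal d ^ k * \<mu> (cone_ball n x r V \<alpha>) < \<mu> (cb n x r)}" for j
    have "\<mu> bad = 0"
      unfolding bad_def using ae ae_e_support[OF \<mu>]
      by (intro is_measure_null_Un[OF \<mu>]) (auto simp: ae_e_def)
    moreover have "\<mu> (A j) = 0" for j
      by (rule null_if_doubling_and_thin_cones[OF \<mu> unrect V(3,1,2) assms(2,3) _ _ k, of _ "inverse (Suc j)" "ennreal d"])
        (auto simp: A_def)
    then have "\<mu> (\<Union>j. A j) = 0"
      by (intro is_measure_null_UN[OF \<mu>]) (auto simp: A_def)
    ultimately have null: "\<mu> (bad \<union> (\<Union>j. A j)) = 0"
      by (intro is_measure_null_Un[OF \<mu>]) (auto simp: A_def bad_def)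
    have "x \<in> (\<Union>j. A j)" if x: "x \<in> RR n" "x \<notin> bad"
      and less: "Limsup (at_right (0::real)) (\<lambda>r. \<mu> (cone_ball n x r V \<alpha>) / \<mu> (cb n x r)) < ennreal c" for x
    proof -
      have pos: "\<And>r. r > 0 \<Longrightarrow> \<mu> (cb n x r) > 0"
        and dbl: "Limsup (at_right (0::real)) (\<lambda>r. \<mu> (cb n x (2 * r)) / \<mu> (cb n x r)) < ennreal d"
        using x unfolding bad_def by (simp_all add: zero_less_iff_neq_zero)
      have "\<forall>x\<in>RR n. \<exists>r>0. \<mu> (cb n x r) < \<infinity>"
        using \<mu> unfolding is_measure_def by (elim conjE)
      \<comment> \<open>Local finiteness keeps the denominators finite at radii below
        \<open>R\<close>.\<close>
      then obtain R where R: "R > 0" "\<mu> (cb n x R) < \<infinity>"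
        using x(1) by blast
      \<comment> \<open>A limsup strictly below a value puts the quotients eventually below it, so
        one \<open>e\<close> serves both quotients and \<open>R\<close>.\<close>
      have "eventually (\<lambda>r. \<mu> (cb n x (2 * r)) / \<mu> (cb n x r) < ennreal d \<and>
          \<mu> (cone_ball n x r V \<alpha>) / \<mu> (cb n x r) < ennreal c \<and> r < R) (at_right 0)"
        using Limsup_lessD[OF dbl] Limsup_lessD[OF less] eventually_at_right_real[OF R(1)]
        by eventually_elim auto
      then obtain e where "e > 0" and e: "\<And>r. 0 < r \<Longrightarrow> r < e \<Longrightarrow>
          \<mu> (cb n x (2 * r)) / \<mu> (cb n x r) < ennreal d \<and>
          \<mu> (cone_ball n x r V \<alpha>) / \<mu> (cb n x r) < ennreal c \<and> r < R"
        by (auto simp: eventually_at_right_field)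
      obtain j where j: "inverse (Suc j) < e" using reals_Archimedean \<open>e > 0\<close> by blast
      have "\<mu> (cb n x (2 * r)) \<le> ennreal d * \<mu> (cb n x r) \<and>
        ennreal d ^ k * \<mu> (cone_ball n x r V \<alpha>) < \<mu> (cb n x r)"
        if r: "0 < r" "r < inverse (Suc j)" for r
      proof
        have er: "\<mu> (cb n x (2 * r)) / \<mu> (cb n x r) < ennreal d"
          "\<mu> (cone_ball n x r V \<alpha>) / \<mu> (cb n x r) < ennreal (1 / d ^ k)" "r < R"
          using e[of r] r j by (auto simp: c_def)
        show "\<mu> (cb n x (2 * r)) \<le> ennreal d * \<mu> (cb n x r)"
          by (rule ennreal_le_of_divide_less[OF er(1)]) (use assms in simp)
        have "\<mu> (cb n x r) \<le> \<mu> (cb n x R)"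
          using er(3) by (intro is_measure_mono[OF \<mu>]) (auto simp: cb_def)
        then have fin: "\<mu> (cb n x r) < top" using R(2) by (auto intro: le_less_trans)
        show "ennreal d ^ k * \<mu> (cone_ball n x r V \<alpha>) < \<mu> (cb n x r)"
          using ennreal_mult_less_of_divide_less[OF er(2) _ pos[OF r(1)] fin] assms
          by (simp add: ennreal_power)
      qed
      then show ?thesis using x(1) by (auto simp: A_def)
    qed
    then have "{x \<in> RR n. \<not> Limsup (at_right (0::real)) (\<lambda>r. \<mu> (cone_ball n x r V \<alpha>) / \<mu> (cb n x r)) \<ge> ennreal c}
        \<subseteq> bad \<union> (\<Union>j. A j)"
      unfolding not_le by blast
    then show ?thesis
      unfolding ae_e_def by (rule is_measure_null_subset[OF \<mu> _ _ null]) (auto simp: A_def bad_def)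
  qed
  show ?thesis
  proof (intro exI[of _ c] conjI allI impI; (elim conjE)?)
    show "c > 0" using assms by (simp add: c_def)
  qed (rule main)
qed

end
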